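(* Let $\Omega\subset\mathbb{R}^n$, $n\ge 2$, be a bounded domain, $b\in C(\partial\Omega)$, and let $g\in C(\mathbb{R},\mathbb{R})$ be such that there exists $s_0\ge 0$ with $g\ge 0$ on $[s_0,\infty)$ and $g\le 0$ on $(-\infty,-s_0]$. Let $f:\Omega\times\mathbb{R}\to[0,\infty)$ be continuous with $\sup_{\Omega\times I}|f(x,t)|<\infty$ for every compact interval $I\subset\mathbb{R}$. Let $\Phi_g$, $\ell$, $\eta_{f,g}$, $H_{f,g}$ and $\zeta_{f,g}$ be as defined in the context, with $\eta_{f,g}$ continuous on $[\ell,\infty)$. Assume that: (i) $\eta_{f,g}(t)>0$ for all $t>\ell$; (ii) $\displaystyle S_{f,g}:=\sup_{a>\ell}\zeta_{f,g}(a)<\infty$. Let $B_R(z)$ be the in-ball of $\Omega$. If $R>S_{f,g}/\sqrt{2}$, then the Dirichlet problem $$\Delta_\infty u+g(u)|Du|^4+f(x,u)=0\ \text{ in }\Omega,\qquad u=b\ \text{ on }\partial\Omega$$ has no viscosity solution $u\in C(\overline\Omega)$ besides, possibly, the constant solution (that is, every viscosity solution $u\in C(\overline\Omega)$ is constant).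
   Context: The infinity-Laplacian is $\Delta_\infty u=\langle D^2u\,Du,Du\rangle$. The in-ball $B_R(z)$ of $\Omega$ is a ball of largest radius contained in $\Omega$, so $R$ is the inradius of $\Omega$. Definitions: $G(s)=\int_0^s g(\tau)\,d\tau$ and $\Phi_g(t)=\int_0^t\mathrm{e}^{G(s)}\,ds$, which is a strictly increasing $C^2$-diffeomorphism of $\mathbb{R}$ onto $\mathbb{R}$ with inverse $\Phi_g^{-1}$. Put $\ell=\inf_{\partial\Omega}\Phi_g(b)$ and $$\eta_{f,g}(t)=\inf_{(x,s)\in\Omega\times[t,\infty)}\mathrm{e}^{3G(\Phi_g^{-1}(s))}f(x,\Phi_g^{-1}(s)),\quad t\ge\ell,$$ $$H_{f,g}(t)=\int_\ell^t\eta_{f,g}(s)\,ds,\qquad \zeta_{f,g}(a)=\int_\ell^a\frac{dt}{\sqrt[4]{H_{f,g}(a)-H_{f,g}(t)}},\quad a>\ell.$$ A function $u\in C(\overline\Omega)$ is a viscosity solution of the Dirichlet problem if $u=b$ on $\partial\Omega$ and the following two conditions hold. Subsolution: whenever $\varphi\in C^2(\Omega)$ and $u-\varphi$ has a local maximum at $x_0\in\Omega$, then $\langle D^2\varphi(x_0)D\varphi(x_0),D\varphi(x_0)\rangle+g(u(x_0))|D\varphi(x_0)|^4+f(x_0,u(x_0))\ge 0$. Supersolution: whenever $\varphi\in C^2(\Omega)$ and $u-\varphi$ has a local minimum at $x_0\in\Omega$, then $\langle D^2\varphi(x_0)D\varphi(x_0),D\varphi(x_0)\rangle+g(u(x_0))|D\varphi(x_0)|^4+f(x_0,u(x_0))\le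 0$. *)

theory Defs
  imports "HOL-Analysis.Analysis"
begin

text \<open>\<open>LBINT\<close> over \<open>0..s\<close> is the oriented integral, so \<open>s < 0\<close> gets the usual sign.\<close>

definition G_prim :: "(real \<Rightarrow> real) \<Rightarrow> real \<Rightarrow> real" where
  "G_prim g s = (LBINT \<tau>=0..s. g \<tau>)"

definition Phi :: "(real \<Rightarrow> real) \<Rightarrow> real \<Rightarrow> real" where
  "Phi g t = (LBINT s=0..t. exp (G_prim g s))"

definition ell :: "(real ^ 'n) set \<Rightarrow> (real ^ 'n \<Rightarrow> real) \<Rightarrow> (real \<Rightarrow> real) \<Rightarrow> real" where
  "ell \<Omega> b g = (INF x\<in>frontier \<Omega>. Phi g (b x))"

definition eta ::
  "(real ^ 'n) set \<Rightarrow> (real ^ 'n \<Rightarrow> real \<Rightarrow> real) \<Rightarrow> (real \<Rightarrow> real) \<Rightarrow> real \<Rightarrow> real" where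
  "eta \<Omega> f g t =
     (INF (x, s)\<in>\<Omega> \<times> {t..}. exp (3 * G_prim g (inv (Phi g) s)) * f x (inv (Phi g) s))"

definition H_fun ::
  "(real ^ 'n) set \<Rightarrow> (real ^ 'n \<Rightarrow> real) \<Rightarrow> (real ^ 'n \<Rightarrow> real \<Rightarrow> real) \<Rightarrow> (real \<Rightarrow> real)
     \<Rightarrow> real \<Rightarrow> real" where
  "H_fun \<Omega> b f g t = (LBINT s=ell \<Omega> b g..t. eta \<Omega> f g s)"

text \<open>The integrand is nonnegative and singular at \<open>a\<close>; the integral takes the value \<open>\<infinity>\<close>
  if it diverges. Division is that of \<^typ>\<open>ennreal\<close>, where \<open>1 / 0 = \<infinity>\<close>.\<close>

definition zeta ::
  "(real ^ 'n) set \<Rightarrow> (real ^ 'n \<Rightarrow> real) \<Rightarrow> (real ^ 'n \<Rightarrow> real \<Rightarrow> real) \<Rightarrow> (real \<Rightarrow> real)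
     \<Rightarrow> real \<Rightarrow> ennreal" where
  "zeta \<Omega> b f g a =
     (\<integral>\<^sup>+ t\<in>{ell \<Omega> b g<..<a}. 1 / ennreal (root 4 (H_fun \<Omega> b f g a - H_fun \<Omega> b f g t)) \<partial>lborel)"

definition S_sup ::
  "(real ^ 'n) set \<Rightarrow> (real ^ 'n \<Rightarrow> real) \<Rightarrow> (real ^ 'n \<Rightarrow> real \<Rightarrow> real) \<Rightarrow> (real \<Rightarrow> real)
     \<Rightarrow> ennreal" where
  "S_sup \<Omega> b f g = (SUP a\<in>{ell \<Omega> b g<..}. zeta \<Omega> b f g a)"

definition is_in_ball :: "'a::metric_space set \<Rightarrow> 'a \<Rightarrow> real \<Rightarrow> bool" where
  "is_in_ball \<Omega> z R \<longleftrightarrow>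
     R > 0 \<and> ball z R \<subseteq> \<Omega> \<and> (\<forall>z' r. ball z' r \<subseteq> \<Omega> \<longrightarrow> r \<le> R)"

text \<open>\<open>\<phi>\<close> is of class \<open>C\<^sup>2\<close> on the (open) set \<open>S\<close>, with gradient \<open>D\<close> and Hessian matrix \<open>D2\<close>;
  on \<open>S\<close> these are determined by \<open>\<phi>\<close>.\<close>

definition C2_with ::
  "(real ^ 'n) set \<Rightarrow> (real ^ 'n \<Rightarrow> real) \<Rightarrow> (real ^ 'n \<Rightarrow> real ^ 'n) \<Rightarrow> (real ^ 'n \<Rightarrow> real ^ 'n ^ 'n)
     \<Rightarrow> bool" where
  "C2_with S \<phi> D D2 \<longleftrightarrow>
     (\<forall>x\<in>S. GDERIV \<phi> x :> D x) \<and>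
     (\<forall>x\<in>S. (D has_derivative (\<lambda>h. D2 x *v h)) (at x)) \<and>
     continuous_on S D2"

definition visc_subsolution ::
  "(real ^ 'n) set \<Rightarrow> (real ^ 'n \<Rightarrow> real \<Rightarrow> real) \<Rightarrow> (real \<Rightarrow> real) \<Rightarrow> (real ^ 'n \<Rightarrow> real) \<Rightarrow> bool" where
  "visc_subsolution \<Omega> f g u \<longleftrightarrow>
     (\<forall>\<phi> D D2 x0. C2_with \<Omega> \<phi> D D2 \<and> x0 \<in> \<Omega> \<and>
        (\<forall>\<^sub>F x in nhds x0. u x - \<phi> x \<le> u x0 - \<phi> x0) \<longrightarrow>
        (D2 x0 *v D x0) \<bullet> D x0 + g (u x0) * norm (D x0) ^ 4 + f x0 (u x0) \<ge> 0)"

definition visc_supersolution ::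
  "(real ^ 'n) set \<Rightarrow> (real ^ 'n \<Rightarrow> real \<Rightarrow> real) \<Rightarrow> (real \<Rightarrow> real) \<Rightarrow> (real ^ 'n \<Rightarrow> real) \<Rightarrow> bool" where
  "visc_supersolution \<Omega> f g u \<longleftrightarrow>
     (\<forall>\<phi> D D2 x0. C2_with \<Omega> \<phi> D D2 \<and> x0 \<in> \<Omega> \<and>
        (\<forall>\<^sub>F x in nhds x0. u x - \<phi> x \<ge> u x0 - \<phi> x0) \<longrightarrow>
        (D2 x0 *v D x0) \<bullet> D x0 + g (u x0) * norm (D x0) ^ 4 + f x0 (u x0) \<le> 0)"

definition visc_solution ::
  "(real ^ 'n) set \<Rightarrow> (real ^ 'n \<Rightarrow> real) \<Rightarrow> (real ^ 'n \<Rightarrow> real \<Rightarrow> real) \<Rightarrow> (real \<Rightarrow> real)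
     \<Rightarrow> (real ^ 'n \<Rightarrow> real) \<Rightarrow> bool" where
  "visc_solution \<Omega> b f g u \<longleftrightarrow>
     continuous_on (closure \<Omega>) u \<and> (\<forall>x\<in>frontier \<Omega>. u x = b x) \<and>
     visc_subsolution \<Omega> f g u \<and> visc_supersolution \<Omega> f g u"

end

theory Submission
  imports Defs
begin

text \<open>
  By the substitution \<open>v = \<Phi>\<^sub>g(u)\<close> the gradient term disappears, and
  \<open>\<Delta>\<^sub>\<infinity> v \<le> - \<eta>(v)\<close> in the viscosity sense. All test functions needed are radial, and
  \<open>\<Delta>\<^sub>\<infinity>\<close> of \<open>\<psi>(|x - z|)\<close> is \<open>\<psi>'\<^sup>2 \<psi>''\<close>. The strong minimum principle (comparison with
  \<open>\<kappa> (e\<^sup>-\<^sup>r - e\<^sup>-\<^sup>r\<^sup>0)\<close> at a boundary point of a ball) shows that \<open>v\<close> is constant or \<open>v > \<ell>\<close> in \<open>\<Omega>\<close>.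

  In the second case let \<open>z'\<close> be close to \<open>z\<close>, \<open>\<ell> < a < v(z')\<close>, and
  \<open>P(s) = \<integral>\<^sub>\<ell>\<^sup>s (H(a) - H(t))\<^sup>-\<^sup>1\<^sup>/\<^sup>4 dt\<close>, so that \<open>P(a) = \<zeta>(a) \<le> S\<close>. Choose \<open>c < \<surd>2\<close> and \<open>r < R\<close>
  with \<open>c r \<ge> S\<close>. If the minimum of \<open>P(min (v x) a) + c |x - z'|\<close> over the ball of radius \<open>r\<close>
  around \<open>z'\<close> were less than \<open>P(a)\<close>, it would be attained neither at \<open>z'\<close> nor on the boundary,
  and the equation satisfied by \<open>P \<circ> v\<close> would give \<open>1 - c\<^sup>4 / 4 \<le> 0\<close>. Hence
  \<open>P(a) - P(v x) \<le> c |x - z'|\<close>. Since \<open>H(a) - H(t) \<le> \<eta>(a) (a - t)\<close>, letting \<open>a\<close> tend to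
  \<open>v(z')\<close> yields \<open>(v z' - v x)\<^sup>3 \<le> c\<^sup>4 \<eta>(v z') |x - z'|\<^sup>4\<close>. As \<open>z'\<close> ranges over a neighbourhood of
  \<open>z\<close>, \<open>v\<close> is Hoelder continuous there with exponent \<open>4/3 > 1\<close>, hence constant, which
  contradicts \<open>\<eta>(v z) > 0\<close>.
\<close>

section \<open>Radial test functions for viscosity supersolutions\<close>

text \<open>A positive \<open>h2\<close> makes \<open>h1\<close> negative just left of
  \<open>c\<close> and positive just right of it; the mean value theorem then compares values of
  \<open>h\<close>. A second derivative is asked for at \<open>c\<close> only, matching the
  regularity of the test functions in \<open>radial_supersol_at\<close>.\<close>

lemma local_min_second_derivative:
  fixes h h1 :: "real \<Rightarrow> real"
  assumes h: "\<forall>\<^sub>F r in nhds c. (h has_real_derivative h1 r) (at r)"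
    and h1: "(h1 has_real_derivative h2) (at c)" and "h1 c = 0" "h2 > 0"
  shows "\<forall>\<^sub>F r in nhds c. h c \<le> h r"
proof -
  obtain d where d: "d > 0" "\<And>r. dist r c < d \<Longrightarrow> (h has_real_derivative h1 r) (at r)"
    using h unfolding eventually_nhds_metric by blast
  obtain dr where dr: "dr > 0" "\<And>t. 0 < t \<Longrightarrow> t < dr \<Longrightarrow> h1 c < h1 (c + t)"
    using DERIV_pos_inc_right[OF h1 \<open>h2 > 0\<close>] by blast
  obtain dl where dl: "dl > 0" "\<And>t. 0 < t \<Longrightarrow> t < dl \<Longrightarrow> h1 (c - t) < h1 c"
    using DERIV_pos_inc_left[OF h1 \<open>h2 > 0\<close>] by blast
  have "h c \<le> h r" if r: "dist r c < min d (min dr dl)" for r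
  proof -
    consider "r = c" | "r > c" | "r < c" by linarith
    then show ?thesis
    proof cases
      case 2
      have "\<exists>y. c < y \<and> y < r \<and> h r - h c = (r - c) * h1 y"
        by (rule MVT2[OF 2]) (use r d(2) in \<open>auto simp: dist_real_def\<close>)
      then obtain y where y: "c < y" "y < r" "h r - h c = (r - c) * h1 y" by blast
      have "h1 y > 0" using dr(2)[of "y - c"] y r 2 \<open>h1 c = 0\<close> by (auto simp: dist_real_def)
      then have "h r - h c > 0" unfolding y(3) using 2 by (intro mult_pos_pos) simp_all
      then show ?thesis by simp
    next
      case 3
      have "\<exists>y. r < y \<and> y < c \<and> h c - h r = (c - r) * h1 y"
        by (rule MVT2[OF 3]) (use r d(2) in \<open>auto simp: dist_real_def\<close>)
      then obtain y where y: "r < y" "y < c" "h c - h r = (c - r) * h1 y" by blast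
      have "h1 y < 0" using dl(2)[of "c - y"] y r 3 \<open>h1 c = 0\<close> by (auto simp: dist_real_def)
      then have "h c - h r < 0" unfolding y(3) using 3 by (intro mult_pos_neg) simp_all
      then show ?thesis by simp
    qed simp
  qed
  moreover have "min d (min dr dl) > 0" using d dr dl by simp
  ultimately show ?thesis unfolding eventually_nhds_metric by blast
qed

text \<open>The viscosity inequality \<open>\<Delta>\<^sub>\<infinity> U + A |DU|\<^sup>4 + N \<le> 0\<close> at \<open>x0\<close>, tested only with functions of the
  distance to a point \<open>z \<noteq> x0\<close>.\<close>

definition radial_supersol_at :: "(real ^ 'n \<Rightarrow> real) \<Rightarrow> real \<Rightarrow> real \<Rightarrow> real ^ 'n \<Rightarrow> bool" where
  "radial_supersol_at U A N x0 \<longleftrightarrow>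
     (\<forall>z \<psi> \<psi>1 \<psi>2. x0 \<noteq> z \<and>
        (\<forall>\<^sub>F r in nhds (dist x0 z). (\<psi> has_real_derivative \<psi>1 r) (at r)) \<and>
        (\<psi>1 has_real_derivative \<psi>2) (at (dist x0 z)) \<and>
        (\<forall>\<^sub>F x in nhds x0. U x0 - \<psi> (dist x0 z) \<le> U x - \<psi> (dist x z)) \<longrightarrow>
        (\<psi>1 (dist x0 z))\<^sup>2 * \<psi>2 + A * \<psi>1 (dist x0 z) ^ 4 + N \<le> 0)"

lemma radial_supersol_atD:
  assumes "radial_supersol_at U A N x0" "x0 \<noteq> z"
    "\<forall>\<^sub>F r in nhds (dist x0 z). (\<psi> has_real_derivative \<psi>1 r) (at r)"
    "(\<psi>1 has_real_derivative \<psi>2) (at (dist x0 z))"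
    "\<forall>\<^sub>F x in nhds x0. U x0 - \<psi> (dist x0 z) \<le> U x - \<psi> (dist x z)"
  shows "(\<psi>1 (dist x0 z))\<^sup>2 * \<psi>2 + A * \<psi>1 (dist x0 z) ^ 4 + N \<le> 0"
  using assms unfolding radial_supersol_at_def by blast

text \<open>Hessians of functions of \<open>|x - z|^2\<close> have this shape, with
  \<open>w = x - z\<close>.\<close>

lemma scalar_plus_rank_one_mult:
  fixes w h :: "real ^ 'n"
  shows "(\<chi> i j. a * (if i = j then 1 else 0) + c * (w $ i * w $ j)) *v h
      = a *\<^sub>R h + (c * (w \<bullet> h)) *\<^sub>R w"
proof -
  have "(\<Sum>j\<in>UNIV. (a * (if i = j then 1 else 0) + c * (w $ i * w $ j)) * h $ j)
      = (\<Sum>j\<in>UNIV. if i = j then a * h $ j else 0) + (\<Sum>j\<in>UNIV. c * w $ i * (w $ j * h $ j))" for i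
    unfolding sum.distrib[symmetric] by (rule sum.cong) (auto simp: algebra_simps)
  then show ?thesis
    by (simp add: vec_eq_iff matrix_vector_mult_def inner_vec_def sum_distrib_left[symmetric])
qed

text \<open>Composing with \<open>|x - z|\<^sup>2\<close> instead of \<open>|x - z|\<close> gives test functions that are smooth at \<open>z\<close> too,
  as \<^const>\<open>visc_supersolution\<close> demands.\<close>

lemma C2_with_quadratic_of_dist_squared:
  fixes z :: "real ^ 'n" and t0 :: real
  defines "\<tau> \<equiv> \<lambda>x. (x - z) \<bullet> (x - z) - t0"
  shows "C2_with S (\<lambda>x. \<beta> * \<tau> x + \<gamma> / 2 * (\<tau> x)\<^sup>2)
           (\<lambda>x. (2 * \<beta> + 2 * \<gamma> * \<tau> x) *\<^sub>R (x - z))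
           (\<lambda>x. \<chi> i j. (2 * \<beta> + 2 * \<gamma> * \<tau> x) * (if i = j then 1 else 0)
                        + 4 * \<gamma> * ((x - z) $ i * (x - z) $ j))"
proof -
  show ?thesis
    unfolding C2_with_def
  proof (intro conjI ballI)
    fix x assume "x \<in> S"
    show "GDERIV (\<lambda>x. \<beta> * \<tau> x + \<gamma> / 2 * (\<tau> x)\<^sup>2) x :> (2 * \<beta> + 2 * \<gamma> * \<tau> x) *\<^sub>R (x - z)"
      unfolding gderiv_def \<tau>_def
      by (rule derivative_eq_intros refl ext)+ (simp add: inner_commute algebra_simps)
    show "((\<lambda>x. (2 * \<beta> + 2 * \<gamma> * \<tau> x) *\<^sub>R (x - z)) has_derivative
       (\<lambda>h. (\<chi> i j. (2 * \<beta> + 2 * \<gamma> * \<tau> x) * (if i = j then 1 else 0)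
                        + 4 * \<gamma> * ((x - z) $ i * (x - z) $ j)) *v h)) (at x)"
      unfolding scalar_plus_rank_one_mult unfolding \<tau>_def
      by (rule derivative_eq_intros refl ext)+ (simp add: inner_commute algebra_simps)
  next
    show "continuous_on S (\<lambda>x. \<chi> i j. (2 * \<beta> + 2 * \<gamma> * \<tau> x) * (if i = j then 1 else 0)
                        + 4 * \<gamma> * ((x - z) $ i * (x - z) $ j))"
      unfolding \<tau>_def by (intro continuous_intros)
  qed
qed

text \<open>Since \<open>\<psi>\<close> need not be C^2, it is replaced by a quadratic polynomial
  \<open>q\<close> in \<open>r^2\<close> with the same slope at \<open>r0\<close> and second
  derivative \<open>\<psi>2 - \<epsilon>\<close>. Then \<open>\<psi> - q\<close> has a local minimum
  at \<open>r0\<close>, so \<open>q\<close> also touches \<open>u\<close> from below. Finally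
  \<epsilon> tends to 0.\<close>

lemma visc_supersolution_imp_radial:
  fixes u :: "real ^ 'n \<Rightarrow> real"
  assumes sup: "visc_supersolution \<Omega> f g u" and "x0 \<in> \<Omega>"
  shows "radial_supersol_at u (g (u x0)) (f x0 (u x0)) x0"
  unfolding radial_supersol_at_def
proof (intro allI impI, elim conjE)
  fix z \<psi> \<psi>1 \<psi>2
  assume "x0 \<noteq> z"
    and d1: "\<forall>\<^sub>F r in nhds (dist x0 z). (\<psi> has_real_derivative \<psi>1 r) (at r)"
    and d2: "(\<psi>1 has_real_derivative \<psi>2) (at (dist x0 z))"
    and lmin: "\<forall>\<^sub>F x in nhds x0. u x0 - \<psi> (dist x0 z) \<le> u x - \<psi> (dist x z)"
  define r0 where "r0 = dist x0 z"
  have r0: "r0 > 0" using \<open>x0 \<noteq> z\<close> by (simp add: r0_def)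
  define p where "p = \<psi>1 r0"
  have eps: "p\<^sup>2 * (\<psi>2 - \<epsilon>) + g (u x0) * p ^ 4 + f x0 (u x0) \<le> 0" if "\<epsilon> > 0" for \<epsilon>
  proof -
    \<comment> \<open>The two constants solve \<open>q'(r0) = 2 r0 \<beta> = p\<close> and
      \<open>q''(r0) = 2 \<beta> + 4 r0^2 \<gamma> = \<psi>2 - \<epsilon>\<close>.\<close>
    define \<beta> where "\<beta> = p / (2 * r0)"
    define \<gamma> where "\<gamma> = (\<psi>2 - \<epsilon> - 2 * \<beta>) / (4 * r0\<^sup>2)"
    define q where "q = (\<lambda>r::real. \<beta> * (r\<^sup>2 - r0\<^sup>2) + \<gamma> / 2 * (r\<^sup>2 - r0\<^sup>2)\<^sup>2)"
    define q1 where "q1 = (\<lambda>r::real. 2 * r * \<beta> + 2 * r * \<gamma> * (r\<^sup>2 - r0\<^sup>2))"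
    have qd: "(q has_real_derivative q1 r) (at r)" for r
      unfolding q_def q1_def by (rule derivative_eq_intros refl)+ (simp add: algebra_simps)
    have q1d: "(q1 has_real_derivative \<psi>2 - \<epsilon>) (at r0)"
      unfolding q1_def
      by (rule derivative_eq_intros refl)+
        (use r0 in \<open>simp add: \<gamma>_def field_simps power2_eq_square\<close>)
    have 1: "\<forall>\<^sub>F r in nhds r0. ((\<lambda>r. \<psi> r - q r) has_real_derivative \<psi>1 r - q1 r) (at r)"
      using d1 unfolding r0_def[symmetric]
      by eventually_elim (auto intro!: derivative_intros qd)
    have 2: "((\<lambda>r. \<psi>1 r - q1 r) has_real_derivative \<epsilon>) (at r0)"
      using DERIV_diff[OF d2[folded r0_def] q1d] by simp
    have ev: "\<forall>\<^sub>F r in nhds r0. \<psi> r0 - q r0 \<le> \<psi> r - q r"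
      by (rule local_min_second_derivative[OF 1 2])
        (use r0 that in \<open>auto simp: q1_def \<beta>_def p_def\<close>)
    have "filterlim (\<lambda>x. dist x z) (nhds r0) (nhds x0)"
      unfolding r0_def by (intro tendsto_intros) (simp add: filterlim_ident)
    from eventually_compose_filterlim[OF ev this] lmin
    have touch: "\<forall>\<^sub>F x in nhds x0. u x0 - q (dist x0 z) \<le> u x - q (dist x z)"
      by eventually_elim (auto simp: r0_def)
    define \<tau> where "\<tau> = (\<lambda>x. (x - z) \<bullet> (x - z) - r0\<^sup>2)"
    have sq: "(dist x z)\<^sup>2 = (x - z) \<bullet> (x - z)" for x
      by (simp add: dist_norm power2_norm_eq_inner)
    have q\<tau>: "q (dist x z) = \<beta> * \<tau> x + \<gamma> / 2 * (\<tau> x)\<^sup>2" for x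
      by (simp add: q_def \<tau>_def sq)
    have \<tau>0: "\<tau> x0 = 0" using sq[of x0] by (simp add: \<tau>_def r0_def)
    have n0: "(x0 - z) \<bullet> (x0 - z) = r0\<^sup>2" using \<tau>0 by (simp add: \<tau>_def)
    define X where "X = ((\<chi> i j. 2 * \<beta> * (if i = j then 1 else 0)
        + 4 * \<gamma> * ((x0 - z) $ i * (x0 - z) $ j)) :: real ^ 'n ^ 'n)"
    have mv: "X *v h = (2 * \<beta>) *\<^sub>R h + (4 * \<gamma> * ((x0 - z) \<bullet> h)) *\<^sub>R (x0 - z)" for h
      unfolding X_def by (rule scalar_plus_rank_one_mult)
    define D where "D = (\<lambda>x. (2 * \<beta> + 2 * \<gamma> * \<tau> x) *\<^sub>R (x - z))"
    define D2 where "D2 = (\<lambda>x. (\<chi> i j. (2 * \<beta> + 2 * \<gamma> * \<tau> x) * (if i = j then 1 else 0)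
        + 4 * \<gamma> * ((x - z) $ i * (x - z) $ j)) :: real ^ 'n ^ 'n)"
    have "C2_with \<Omega> (\<lambda>x. q (dist x z)) D D2"
      unfolding q\<tau> D_def D2_def \<tau>_def by (rule C2_with_quadratic_of_dist_squared)
    with sup touch \<open>x0 \<in> \<Omega>\<close>
    have "(D2 x0 *v D x0) \<bullet> D x0 + g (u x0) * norm (D x0) ^ 4 + f x0 (u x0) \<le> 0"
      unfolding visc_supersolution_def by blast
    moreover have "D2 x0 = X" by (simp add: D2_def X_def \<tau>0)
    moreover have "D x0 = (2 * \<beta>) *\<^sub>R (x0 - z)" by (simp add: D_def \<tau>0)
    \<comment> \<open>The radial vector \<open>x0 - z\<close> is an eigenvector of \<open>X\<close>
      with eigenvalue \<open>2 \<beta> + 4 \<gamma> r0^2 = \<psi>2 - \<epsilon>\<close>, and the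
      gradient is a multiple of it with norm \<open>|p|\<close>.\<close>
    moreover have "(X *v ((2 * \<beta>) *\<^sub>R (x0 - z))) \<bullet> ((2 * \<beta>) *\<^sub>R (x0 - z)) = p\<^sup>2 * (\<psi>2 - \<epsilon>)"
      using r0 unfolding mv
      by (simp add: n0 inner_add_left) (simp add: \<gamma>_def \<beta>_def field_simps power2_eq_square)
    moreover have "norm ((2 * \<beta>) *\<^sub>R (x0 - z)) ^ 4 = p ^ 4"
      using r0 by (simp add: \<beta>_def dist_norm[symmetric] r0_def[symmetric] power_mult_distrib[symmetric]
        power_divide power_mult_distrib)
    ultimately show ?thesis by simp
  qed
  have "p\<^sup>2 * \<psi>2 + g (u x0) * p ^ 4 + f x0 (u x0) \<le> 0 + e" if "e > 0" for e
  proof -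
    \<comment> \<open>The \<open>+ 1\<close> in the denominator covers the case
      \<open>p = 0\<close>.\<close>
    have "p\<^sup>2 * (e / (p\<^sup>2 + 1)) \<le> e"
      using that add_nonneg_pos[of "p\<^sup>2" 1] by (simp add: field_simps)
    then show ?thesis using eps[of "e / (p\<^sup>2 + 1)"] that
      add_nonneg_pos[of "p\<^sup>2" 1]
      by (simp add: algebra_simps)
  qed
  then show "(\<psi>1 (dist x0 z))\<^sup>2 * \<psi>2 + g (u x0) * \<psi>1 (dist x0 z) ^ 4 + f x0 (u x0) \<le> 0"
    unfolding p_def r0_def by (rule field_le_epsilon)
qed

section \<open>Change of the dependent variable\<close>

lemma local_inverse_of_increasing:
  fixes K K1 :: "real \<Rightarrow> real"
  assumes K: "\<forall>\<^sub>F s in nhds s0. (K has_real_derivative K1 s) (at s)"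
    and "isCont K1 s0" "K1 s0 > 0"
  obtains J l h where "l < s0" "s0 < h" "strict_mono_on {l..h} K"
    "\<And>y. y \<in> {K l<..<K h} \<Longrightarrow> J y \<in> {l<..<h} \<and> K (J y) = y"
    "\<And>y. y \<in> {K l<..<K h} \<Longrightarrow> (J has_real_derivative inverse (K1 (J y))) (at y)"
proof -
  have "\<forall>\<^sub>F s in nhds s0. K1 s > 0"
    using assms(2,3) by (intro order_tendstoD(1)[of K1]) (simp_all add: isCont_def tendsto_at_iff_tendsto_nhds)
  with K have "\<forall>\<^sub>F s in nhds s0. (K has_real_derivative K1 s) (at s) \<and> K1 s > 0"
    by eventually_elim simp
  then obtain d where d: "d > 0" "\<And>s. dist s s0 < d \<Longrightarrow> (K has_real_derivative K1 s) (at s) \<and> K1 s > 0"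
    unfolding eventually_nhds_metric by blast
  define l where "l = s0 - d / 2"
  define h where "h = s0 + d / 2"
  define I where "I = {l..h}"
  have K: "(K has_real_derivative K1 s) (at s)" "K1 s > 0" if "s \<in> I" for s
    using that d by (auto simp: I_def l_def h_def dist_real_def)
  have mono: "strict_mono_on I K"
  proof (rule strict_mono_onI)
    fix r s assume "r \<in> I" "s \<in> I" "r < s"
    then show "K r < K s"
      by (intro DERIV_pos_imp_increasing[of r s K]) (auto intro!: K exI simp: I_def)
  qed
  have contK: "continuous_on I K"
    by (meson K(1) DERIV_isCont continuous_at_imp_continuous_on)
  define J where "J = inv_into I K"
  have JK: "J (K s) = s" if "s \<in> I" for s
    using that mono unfolding J_def by (intro inv_into_f_f strict_mono_on_imp_inj_on)
  have contJ: "continuous_on (K ` I) J"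
    by (rule continuous_on_inv[OF contK]) (auto simp: I_def JK)
  have surj: "\<exists>s\<in>I. K s = y" if "y \<in> {K l..K h}" for y
    using IVT'[of K l y h] that contK d(1) by (auto simp: I_def l_def h_def)
  have J: "J y \<in> {l<..<h} \<and> K (J y) = y" if y: "y \<in> {K l<..<K h}" for y
  proof -
    obtain s where s: "s \<in> I" "K s = y" using surj[of y] y by auto
    then have "s \<noteq> l" "s \<noteq> h" using y by auto
    then show ?thesis using s JK[of s] by (auto simp: I_def)
  qed
  have "{K l<..<K h} \<subseteq> K ` I"
  proof
    fix y assume "y \<in> {K l<..<K h}"
    then have "\<exists>s\<in>I. K s = y" by (intro surj) simp
    then show "y \<in> K ` I" by blast
  qed
  then have contJ': "continuous_on {K l<..<K h} J" by (rule continuous_on_subset[OF contJ])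
  have "(J has_real_derivative inverse (K1 (J y))) (at y)" if y: "y \<in> {K l<..<K h}" for y
  proof (rule DERIV_inverse_function[where f = K and a = "K l" and b = "K h"])
    show "isCont J y" using contJ' y by (simp add: continuous_on_eq_continuous_at)
    show "(K has_real_derivative K1 (J y)) (at (J y))" "K1 (J y) \<noteq> 0"
      using K[of "J y"] J[OF y] by (auto simp: I_def)
  qed (use y J in auto)
  with J mono d(1) show ?thesis
    by (intro that[of l h J]) (auto simp: I_def l_def h_def)
qed

text \<open>If \<open>\<psi>\<close> touches \<open>K o U\<close> from below, then
  \<open>\<rho> = J o (\<psi> + c)\<close>, with \<open>J\<close> the local inverse of
  \<open>K\<close>, touches \<open>U\<close> from below. The coefficients come from the chain rule
  for \<open>\<rho>\<close>, after multiplication by \<open>K1^3\<close>. It serves twice: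
  \<open>K = Phi g\<close> removes the gradient term, and the singular profile \<open>P\<close>
  creates a favourable one.\<close>

lemma radial_supersol_at_compose:
  fixes U :: "real ^ 'n \<Rightarrow> real"
  assumes U: "radial_supersol_at U A N x0" and cont: "isCont U x0"
    and K: "\<forall>\<^sub>F s in nhds (U x0). (K has_real_derivative K1 s) (at s)"
    and K1: "(K1 has_real_derivative K2) (at (U x0))" and pos: "K1 (U x0) > 0"
  shows "radial_supersol_at (\<lambda>x. K (U x)) (A / K1 (U x0) - K2 / (K1 (U x0))\<^sup>2) (K1 (U x0) ^ 3 * N) x0"
  unfolding radial_supersol_at_def
proof (intro allI impI, elim conjE)
  fix z \<psi> \<psi>1 \<psi>2
  assume "x0 \<noteq> z"
    and d1: "\<forall>\<^sub>F r in nhds (dist x0 z). (\<psi> has_real_derivative \<psi>1 r) (at r)"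
    and d2: "(\<psi>1 has_real_derivative \<psi>2) (at (dist x0 z))"
    and lmin: "\<forall>\<^sub>F x in nhds x0. K (U x0) - \<psi> (dist x0 z) \<le> K (U x) - \<psi> (dist x z)"
  define r0 where "r0 = dist x0 z"
  define s0 where "s0 = U x0"
  define p where "p = \<psi>1 r0"
  define k where "k = K1 s0"
  have k: "k > 0" using pos by (simp add: k_def s0_def)
  obtain J l h where J: "l < s0" "s0 < h" "strict_mono_on {l..h} K"
    "\<And>y. y \<in> {K l<..<K h} \<Longrightarrow> J y \<in> {l<..<h} \<and> K (J y) = y"
    "\<And>y. y \<in> {K l<..<K h} \<Longrightarrow> (J has_real_derivative inverse (K1 (J y))) (at y)"
    using local_inverse_of_increasing[OF K DERIV_isCont[OF K1] pos] unfolding s0_def by metis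
  \<comment> \<open>The shift makes the touching value equal to \<open>K s0\<close>, so that
    \<open>\<rho> r0 = s0\<close>.\<close>
  define c where "c = K s0 - \<psi> r0"
  define \<rho> where "\<rho> = (\<lambda>r. J (\<psi> r + c))"
  define \<rho>1 where "\<rho>1 = (\<lambda>r. inverse (K1 (\<rho> r)) * \<psi>1 r)"
  have Ks0: "K s0 \<in> {K l<..<K h}" using J(1-3) by (auto simp: strict_mono_on_def)
  have \<rho>0: "\<rho> r0 = s0"
  proof -
    have "K (J (K s0)) = K s0" "J (K s0) \<in> {l<..<h}" using J(4)[OF Ks0] by auto
    then have "J (K s0) = s0"
      using strict_mono_on_imp_inj_on[OF J(3)] J(1,2) by (auto simp: inj_on_def)
    then show ?thesis by (simp add: \<rho>_def c_def)
  qed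
  have "(\<psi> has_real_derivative \<psi>1 r0) (at r0)"
    using d1 unfolding r0_def[symmetric] by (rule eventually_nhds_x_imp_x)
  then have "isCont (\<lambda>r. \<psi> r + c) r0" by (intro continuous_intros DERIV_isCont)
  then have "filterlim (\<lambda>r. \<psi> r + c) (nhds (\<psi> r0 + c)) (nhds r0)"
    using tendsto_at_iff_tendsto_nhds[of "\<lambda>r. \<psi> r + c" r0] by (simp add: isCont_def)
  then have lim: "filterlim (\<lambda>r. \<psi> r + c) (nhds (K s0)) (nhds r0)" by (simp add: c_def)
  have inJ: "\<forall>\<^sub>F r in nhds r0. \<psi> r + c \<in> {K l<..<K h}"
    by (rule eventually_compose_filterlim[OF eventually_nhds_in_open[OF open_greaterThanLessThan Ks0] lim])
  have \<rho>d: "\<forall>\<^sub>F r in nhds r0. (\<rho> has_real_derivative \<rho>1 r) (at r)"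
    using inJ d1 unfolding r0_def[symmetric]
  proof eventually_elim
    case (elim r)
    then show ?case unfolding \<rho>_def \<rho>1_def
      by (auto intro!: DERIV_chain2[of J "inverse (K1 (J (\<psi> r + c)))"] J(5) derivative_eq_intros)
  qed
  then have \<rho>0d: "(\<rho> has_real_derivative \<rho>1 r0) (at r0)" by (rule eventually_nhds_x_imp_x)
  have K\<rho>: "((\<lambda>r. K1 (\<rho> r)) has_real_derivative K2 * \<rho>1 r0) (at r0)"
    by (rule DERIV_chain2[OF _ \<rho>0d]) (use K1 in \<open>simp add: \<rho>0 s0_def\<close>)
  \<comment> \<open>This is the second derivative of \<open>\<rho>\<close>: with
    \<open>K'(\<rho>) \<rho>' = \<psi>'\<close>, differentiating again gives
    \<open>\<rho>'' = \<psi>''/K' - K'' \<psi>'^2 / K'^3\<close>.\<close>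
  have \<rho>1d: "(\<rho>1 has_real_derivative \<psi>2 / k - p\<^sup>2 * K2 / k ^ 3) (at r0)"
  proof -
    have "(\<rho>1 has_real_derivative
        - (K2 * \<rho>1 r0 * inverse (k ^ Suc (Suc 0))) * p + \<psi>2 * inverse k) (at r0)"
      using DERIV_mult[OF DERIV_inverse_fun[OF K\<rho>] d2[folded r0_def]] k
      by (simp add: \<rho>0 k_def p_def \<rho>1_def[symmetric])
    moreover have "- (K2 * \<rho>1 r0 * inverse (k ^ Suc (Suc 0))) * p + \<psi>2 * inverse k
        = \<psi>2 / k - p\<^sup>2 * K2 / k ^ 3"
      using k by (simp add: \<rho>1_def \<rho>0 k_def[symmetric] p_def[symmetric] field_simps eval_nat_numeral)
    ultimately show ?thesis by simp
  qed
  have limd: "filterlim (\<lambda>x. dist x z) (nhds r0) (nhds x0)"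
    unfolding r0_def by (intro tendsto_intros) (simp add: filterlim_ident)
  have limU: "filterlim U (nhds s0) (nhds x0)"
    using cont by (simp add: isCont_def tendsto_at_iff_tendsto_nhds s0_def)
  have inI: "\<forall>\<^sub>F x in nhds x0. U x \<in> {l<..<h}"
    by (rule eventually_compose_filterlim[OF eventually_nhds_in_open[OF open_greaterThanLessThan] limU])
      (use J(1,2) in simp)
  have "\<forall>\<^sub>F x in nhds x0. U x0 - \<rho> (dist x0 z) \<le> U x - \<rho> (dist x z)"
    using lmin inI eventually_compose_filterlim[OF inJ limd]
  proof eventually_elim
    case (elim x)
    have "K (\<rho> (dist x z)) \<le> K (U x)"
      using J(4)[OF elim(3)] elim(1) by (simp add: \<rho>_def c_def s0_def r0_def)
    moreover have "\<rho> (dist x z) \<in> {l..h}" "U x \<in> {l..h}"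
      using J(4)[OF elim(3)] elim(2) by (auto simp: \<rho>_def)
    ultimately have "\<rho> (dist x z) \<le> U x"
      using J(3) by (meson linorder_not_less strict_mono_onD)
    then show ?case using \<rho>0 by (simp add: r0_def s0_def)
  qed
  from radial_supersol_atD[OF U \<open>x0 \<noteq> z\<close> \<rho>d[unfolded r0_def] \<rho>1d[unfolded r0_def] this]
  have "(p / k)\<^sup>2 * (\<psi>2 / k - p\<^sup>2 * K2 / k ^ 3) + A * (p / k) ^ 4 + N \<le> 0"
    by (simp add: \<rho>1_def r0_def[symmetric] \<rho>0 k_def[symmetric] p_def[symmetric] field_simps)
  then have "k ^ 3 * ((p / k)\<^sup>2 * (\<psi>2 / k - p\<^sup>2 * K2 / k ^ 3) + A * (p / k) ^ 4 + N) \<le> k ^ 3 * 0"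
    using k by (intro mult_left_mono) auto
  moreover have "k ^ 3 * ((p / k)\<^sup>2 * (\<psi>2 / k - p\<^sup>2 * K2 / k ^ 3) + A * (p / k) ^ 4 + N)
      = p\<^sup>2 * \<psi>2 + (A / k - K2 / k\<^sup>2) * p ^ 4 + k ^ 3 * N"
    using k by (simp add: field_simps eval_nat_numeral)
  ultimately show "(\<psi>1 (dist x0 z))\<^sup>2 * \<psi>2 + (A / K1 (U x0) - K2 / (K1 (U x0))\<^sup>2) * \<psi>1 (dist x0 z) ^ 4
      + K1 (U x0) ^ 3 * N \<le> 0"
    by (simp add: p_def r0_def k_def s0_def)
qed

section \<open>Strong minimum principle\<close>

text \<open>The set \<open>Z\<close> of minimum points is relatively closed. If it were not open, a
  ball centred at a non-minimum point \<open>x1\<close> would reach it first at some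
  \<open>x0\<close>, and a strictly convex radial barrier on an annulus around \<open>x1\<close>
  would touch \<open>v\<close> from below where the inequality fails.\<close>

lemma strong_minimum_principle:
  fixes v :: "real ^ 'n \<Rightarrow> real"
  assumes "open \<Omega>" "connected \<Omega>" and cont: "continuous_on \<Omega> v"
    and ge: "\<And>x. x \<in> \<Omega> \<Longrightarrow> m \<le> v x"
    and super: "\<And>x. x \<in> \<Omega> \<Longrightarrow> radial_supersol_at v 0 (N x) x"
    and N: "\<And>x. x \<in> \<Omega> \<Longrightarrow> N x \<ge> 0"
    and p: "p \<in> \<Omega>" "v p = m" and x: "x \<in> \<Omega>"
  shows "v x = m"
proof -
  define Z where "Z = {x \<in> \<Omega>. v x = m}"
  have "\<exists>e>0. ball p e \<subseteq> Z" if "p \<in> Z" for p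
  proof -
    have p: "p \<in> \<Omega>" "v p = m" using that by (auto simp: Z_def)
    obtain e0 where e0: "e0 > 0" "cball p e0 \<subseteq> \<Omega>"
      using \<open>open \<Omega>\<close> p(1) open_contains_cball by blast
    \<comment> \<open>The outer radius of the annulus below is \<open>r + e < 2 e\<close> and its
      centre is within \<open>e\<close> of \<open>p\<close>, so it stays in
      \<open>cball p (3 * e)\<close>.\<close>
    define e where "e = e0 / 3"
    have e: "e > 0" "cball p (3 * e) \<subseteq> \<Omega>" using e0 by (auto simp: e_def)
    have "v x1 = m" if x1: "x1 \<in> ball p e" for x1
    proof (rule ccontr)
      assume "v x1 \<noteq> m"
      define C where "C = {x \<in> cball p (3 * e). v x = m}"
      have contC: "continuous_on (cball p (3 * e)) v" using cont e(2) continuous_on_subset by blast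
      have "closed C"
        using continuous_closed_preimage_constant[OF contC closed_cball, of m] by (simp add: C_def)
      moreover have "p \<in> C" using p e(1) by (simp add: C_def)
      ultimately obtain x0 where x0: "x0 \<in> C" "\<And>y. y \<in> C \<Longrightarrow> dist x1 x0 \<le> dist x1 y"
        using distance_attains_inf[of C x1] by blast
      define r where "r = dist x1 x0"
      have re: "r < e" using x0(2)[OF \<open>p \<in> C\<close>] x1 by (simp add: r_def dist_commute)
      have "x1 \<noteq> x0" using x0(1) \<open>v x1 \<noteq> m\<close> by (auto simp: C_def)
      then have r: "r > 0" by (simp add: r_def)
      have in3: "y \<in> cball p (3 * e)" if "dist y x1 \<le> r + e" for y
      proof -
        have "dist p y \<le> dist p x1 + dist y x1" by (metis dist_commute dist_triangle)
        then show ?thesis using that re x1 by simp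
      qed
      define S where "S = sphere x1 (r / 2)"
      have S3: "S \<subseteq> cball p (3 * e)"
        using r e(1) by (auto simp: S_def dist_commute intro!: in3)
      have "compact S" "S \<noteq> {}" using r by (simp_all add: S_def)
      then obtain y where y: "y \<in> S" "\<And>w. w \<in> S \<Longrightarrow> v y \<le> v w"
        using continuous_attains_inf[of S v] continuous_on_subset[OF contC S3] by blast
      \<comment> \<open>This excess is positive because points at distance \<open>r / 2\<close> from
        \<open>x1\<close> are closer to it than the nearest minimum point \<open>x0\<close>.\<close>
      define \<kappa> where "\<kappa> = v y - m"
      have "v y \<noteq> m"
      proof
        assume "v y = m"
        then have "r \<le> dist x1 y" unfolding r_def using y(1) S3 by (intro x0(2)) (auto simp: C_def)
        then show False using y(1) r by (simp add: S_def)
      qed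
      moreover have "v y \<ge> m" using ge y(1) S3 e(2) by blast
      ultimately have \<kappa>: "\<kappa> > 0" by (simp add: \<kappa>_def)
      define \<psi> where "\<psi> = (\<lambda>t. \<kappa> * (exp (- t) - exp (- r)))"
      \<comment> \<open>On this annulus \<open>v - \<psi>(dist _ x1)\<close> equals \<open>m\<close>
        at \<open>x0\<close>. It exceeds \<open>m\<close> on the inner sphere, where
        \<open>v \<ge> m + \<kappa>\<close> and \<open>\<psi> < \<kappa>\<close>, and on the outer
        one, where \<open>\<psi> < 0\<close>. Its minimum is therefore interior.\<close>
      define A where "A = cball x1 (r + e) - ball x1 (r / 2)"
      have A3: "A \<subseteq> cball p (3 * e)" by (auto simp: A_def dist_commute intro!: in3)
      have "x0 \<in> A" using r e(1) by (simp add: A_def r_def)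
      have "continuous_on A (\<lambda>x. v x - \<psi> (dist x x1))"
        unfolding \<psi>_def by (intro continuous_intros continuous_on_subset[OF contC A3])
      moreover have "compact A" by (simp add: A_def compact_diff)
      ultimately obtain q where q: "q \<in> A"
        "\<And>w. w \<in> A \<Longrightarrow> v q - \<psi> (dist q x1) \<le> v w - \<psi> (dist w x1)"
        using continuous_attains_inf[of A "\<lambda>x. v x - \<psi> (dist x x1)"] \<open>x0 \<in> A\<close> by blast
      have "v x0 = m" using x0(1) by (simp add: C_def)
      then have qm: "v q - \<psi> (dist q x1) \<le> m"
        using q(2)[OF \<open>x0 \<in> A\<close>] by (simp add: \<psi>_def r_def dist_commute)
      have q\<Omega>: "q \<in> \<Omega>" using q(1) A3 e(2) by blast
      have "dist q x1 \<noteq> r / 2"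
      proof
        assume "dist q x1 = r / 2"
        then have "v y \<le> v q" by (intro y(2)) (simp add: S_def dist_commute)
        moreover have "\<psi> (r / 2) < \<kappa> * 1"
          unfolding \<psi>_def using \<kappa> r by (intro mult_strict_left_mono) (auto intro: less_trans[of _ "exp (- (r / 2))"])
        ultimately show False using qm \<open>dist q x1 = r / 2\<close> by (simp add: \<kappa>_def)
      qed
      moreover have "dist q x1 \<noteq> r + e"
      proof
        assume "dist q x1 = r + e"
        moreover have "\<psi> (r + e) < 0" using \<kappa> e(1) by (simp add: \<psi>_def mult_less_0_iff)
        ultimately show False using qm ge[OF q\<Omega>] by simp
      qed
      ultimately have qin: "q \<in> ball x1 (r + e) - cball x1 (r / 2)"
        using q(1) by (auto simp: A_def dist_commute)
      have "\<forall>\<^sub>F x in nhds q. x \<in> ball x1 (r + e) - cball x1 (r / 2)"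
        by (rule eventually_nhds_in_open[OF _ qin]) (simp add: open_Diff)
      then have lmin: "\<forall>\<^sub>F x in nhds q. v q - \<psi> (dist q x1) \<le> v x - \<psi> (dist x x1)"
        by eventually_elim (auto simp: A_def intro!: q(2))
      have \<psi>d: "(\<psi> has_real_derivative - \<kappa> * exp (- t)) (at t)" for t
        unfolding \<psi>_def by (auto intro!: derivative_eq_intros)
      \<comment> \<open>Here \<open>\<psi>'^2 \<psi>''\<close> is positive, whereas the inequality
        bounds it by \<open>- N q \<le> 0\<close>.\<close>
      have "(- \<kappa> * exp (- dist q x1))\<^sup>2 * (\<kappa> * exp (- dist q x1))
          + 0 * (- \<kappa> * exp (- dist q x1)) ^ 4 + N q \<le> 0"
        by (rule radial_supersol_atD[OF super[OF q\<Omega>] _ _ _ lmin, where ?\<psi>1.0 = "\<lambda>t. - \<kappa> * exp (- t)"])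
          (use qin r in \<open>auto intro!: always_eventually \<psi>d[simplified] derivative_eq_intros\<close>)
      moreover have "(- \<kappa> * exp (- dist q x1))\<^sup>2 * (\<kappa> * exp (- dist q x1)) > 0" using \<kappa> by simp
      ultimately show False using N[OF q\<Omega>] by linarith
    qed
    moreover have "ball p e \<subseteq> cball p (3 * e)" using e(1) by auto
    ultimately have "ball p e \<subseteq> Z" unfolding Z_def using e(2) by blast
    then show ?thesis using e(1) by blast
  qed
  then have "open Z" unfolding open_contains_ball by blast
  then have "openin (top_of_set \<Omega>) Z" by (auto simp: Z_def intro: open_openin_trans[OF \<open>open \<Omega>\<close>])
  moreover have "closedin (top_of_set \<Omega>) Z"
    using continuous_closedin_preimage_constant[OF cont, of m] by (simp add: Z_def)
  ultimately have "Z = {} \<or> Z = \<Omega>"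
    using \<open>connected \<Omega>\<close> unfolding connected_clopen by blast
  then show ?thesis using p x by (auto simp: Z_def)
qed

section \<open>Hoelder rigidity, the singular profile and comparison with cones\<close>

text \<open>An exponent above 1 forces the derivative to vanish everywhere on the ball, which is
  convex.\<close>

lemma constant_on_ball_if_Hoelder_four_thirds:
  fixes v :: "'a::real_normed_vector \<Rightarrow> real"
  assumes H: "\<And>x y. x \<in> ball z \<delta> \<Longrightarrow> y \<in> ball z \<delta> \<Longrightarrow> \<bar>v x - v y\<bar> ^ 3 \<le> C * dist x y ^ 4"
    and x: "x \<in> ball z \<delta>"
  shows "v x = v z"
proof -
  have z: "z \<in> ball z \<delta>" using x by (auto intro: le_less_trans[OF zero_le_dist])
  have "(v has_derivative (\<lambda>h. 0)) (at y within ball z \<delta>)" if y: "y \<in> ball z \<delta>" for y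
    unfolding has_derivative_within_alt
  proof (intro conjI allI impI)
    fix e :: real assume "e > 0"
    \<comment> \<open>A violation of the derivative estimate at \<open>w\<close> would give
      \<open>e^3 < |C| |w - y|\<close>; the \<open>+ 1\<close> avoids division by zero.\<close>
    define d where "d = e ^ 3 / (\<bar>C\<bar> + 1)"
    have d: "d > 0" using \<open>e > 0\<close> by (simp add: d_def)
    have "norm (v w - v y - 0) \<le> e * norm (w - y)"
      if w: "w \<in> ball z \<delta>" "norm (w - y) < d" for w
    proof (rule ccontr)
      assume "\<not> ?thesis"
      then have less: "e * norm (w - y) < \<bar>v w - v y\<bar>" by simp
      have "w \<noteq> y" using less by auto
      then have n: "norm (w - y) > 0" by simp
      have "(e * norm (w - y)) ^ 3 < \<bar>v w - v y\<bar> ^ 3"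
        using less \<open>e > 0\<close> by (intro power_strict_mono) auto
      also have "\<dots> \<le> C * norm (w - y) ^ 4" using H[OF w(1) y] by (simp add: dist_norm)
      also have "\<dots> \<le> \<bar>C\<bar> * norm (w - y) ^ 4" by (intro mult_right_mono) auto
      finally have "norm (w - y) ^ 3 * e ^ 3 < norm (w - y) ^ 3 * (\<bar>C\<bar> * norm (w - y))"
        by (simp add: power_mult_distrib eval_nat_numeral mult_ac)
      then have "e ^ 3 < \<bar>C\<bar> * norm (w - y)" using n by simp
      also have "\<dots> \<le> (\<bar>C\<bar> + 1) * norm (w - y)" by (intro mult_right_mono) auto
      also have "\<dots> < (\<bar>C\<bar> + 1) * d" using w(2) by (intro mult_strict_left_mono) auto
      also have "\<dots> = e ^ 3" by (simp add: d_def)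
      finally show False by simp
    qed
    then show "\<exists>d>0. \<forall>w\<in>ball z \<delta>. norm (w - y) < d \<longrightarrow> norm (v w - v y - 0) \<le> e * norm (w - y)"
      using d by blast
  qed auto
  then obtain c where "\<And>y. y \<in> ball z \<delta> \<Longrightarrow> v y = c"
    using has_derivative_zero_constant[of "ball z \<delta>" v] by auto
  then show ?thesis using x z by simp
qed

text \<open>Finiteness of the nonnegative integral makes the integrand integrable up to its
  singularity at \<open>a\<close>, so its primitive is continuous there too.\<close>

lemma singular_profile_primitive:
  fixes H :: "real \<Rightarrow> real"
  assumes "l < a" and cont: "continuous_on {l..a} H"
    and less: "\<And>t. l \<le> t \<Longrightarrow> t < a \<Longrightarrow> H t < H a"
    and le: "(\<integral>\<^sup>+ t\<in>{l<..<a}. 1 / ennreal (root 4 (H a - H t)) \<partial>lborel) \<le> ennreal S" and "S \<ge> 0"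
  obtains P where "continuous_on {l..a} P" "P l = 0" "P a \<le> S"
    "\<And>s. s \<in> {l<..<a} \<Longrightarrow> (P has_real_derivative (H a - H s) powr (-1/4)) (at s)"
proof -
  define k where "k = (\<lambda>t. (H a - H t) powr (-1/4))"
  define f where "f = (\<lambda>t. indicator {l<..<a} t *\<^sub>R k t)"
  have contk: "continuous_on {l<..<a} k"
    unfolding k_def
  proof (rule continuous_on_powr)
    have "continuous_on {l<..<a} H" by (rule continuous_on_subset[OF cont]) auto
    then show "continuous_on {l<..<a} (\<lambda>t. H a - H t)" by (intro continuous_intros)
    show "\<forall>t\<in>{l<..<a}. H a - H t \<noteq> 0"
    proof
      fix t assume "t \<in> {l<..<a}"
      then show "H a - H t \<noteq> 0" using less[of t] by simp
    qed
  qed (rule continuous_on_const)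
  have "f \<in> borel_measurable borel"
    unfolding f_def by (intro borel_measurable_continuous_on_indicator contk) auto
  moreover have "f t \<ge> 0" for t by (simp add: f_def k_def)
  moreover have eq: "(\<integral>\<^sup>+ t. ennreal (f t) \<partial>lborel)
      = (\<integral>\<^sup>+ t\<in>{l<..<a}. 1 / ennreal (root 4 (H a - H t)) \<partial>lborel)"
  proof (intro nn_integral_cong)
    fix t
    show "ennreal (f t) = 1 / ennreal (root 4 (H a - H t)) * indicator {l<..<a} t"
    proof (cases "t \<in> {l<..<a}")
      case True
      then have "H a - H t > 0" using less[of t] by simp
      then have "root 4 (H a - H t) > 0" "k t = 1 / root 4 (H a - H t)"
        using root_powr_inverse[of 4 "H a - H t"] powr_minus_divide[of "H a - H t" "1/4"]
        unfolding k_def by simp_all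
      then show ?thesis using True divide_ennreal[of 1 "root 4 (H a - H t)"] by (simp add: f_def)
    qed (simp add: f_def)
  qed
  moreover obtain r where r: "(\<integral>\<^sup>+ t. ennreal (f t) \<partial>lborel) = ennreal r" "r \<ge> 0" "r \<le> S"
    using le \<open>S \<ge> 0\<close> unfolding eq
    by (cases "\<integral>\<^sup>+ t\<in>{l<..<a}. 1 / ennreal (root 4 (H a - H t)) \<partial>lborel" rule: ennreal_cases)
      (auto simp: top_unique)
  ultimately have "(f has_integral r) UNIV" by (intro nn_integral_has_integral)
  moreover have "f = (\<lambda>t. if t \<in> {l<..<a} then k t else 0)" by (auto simp: f_def)
  ultimately have "(k has_integral r) {l<..<a}" by (simp only: has_integral_restrict_UNIV)
  \<comment> \<open>At \<open>a\<close> the function \<open>k\<close> takes the default value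
    \<open>0 powr (-1/4) = 0\<close>; the endpoints do not affect the integral.\<close>
  then have k: "(k has_integral r) {l..a}" by (simp add: has_integral_Icc_iff_Ioo)
  define P where "P = (\<lambda>s. integral {l..s} k)"
  show ?thesis
  proof
    show "continuous_on {l..a} P"
      unfolding P_def using k by (intro indefinite_integral_continuous_1) auto
    show "P l = 0" "P a \<le> S" using k r by (auto simp: P_def integral_unique)
    fix s assume s: "s \<in> {l<..<a}"
    have "continuous (at s) k"
      using contk s by (simp add: continuous_on_eq_continuous_at)
    then have "(P has_vector_derivative k s) (at s within ({l..a} - {}))"
      unfolding P_def using k s
      by (intro integral_has_vector_derivative_continuous_at) (auto intro: continuous_at_imp_continuous_at_within)
    then have "(P has_vector_derivative k s) (at s)"
      using s at_within_interior[of s "{l..a}"] by simp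
    then show "(P has_real_derivative (H a - H s) powr (-1/4)) (at s)"
      by (simp add: has_real_derivative_iff_has_vector_derivative k_def)
  qed
qed

text \<open>\<open>P o v\<close> is compared with a downward cone of slope \<open>c\<close> and
  vertex \<open>z\<close>; the condition \<open>c ^ 4 < 4\<close> excludes interior contact. The
  resulting bound on \<open>P a - P (v x)\<close> is turned into one on \<open>a - v x\<close> by
  the mean value theorem.\<close>

lemma radial_supersol_growth_bound:
  fixes v :: "real ^ 'n \<Rightarrow> real"
  assumes "r > 0" and contv: "continuous_on (cball z r) v"
    and super: "\<And>x. x \<in> ball z r \<Longrightarrow> radial_supersol_at v 0 (N x) x"
    and N: "\<And>x. x \<in> ball z r \<Longrightarrow> \<eta> (v x) \<le> N x"
    and vl: "\<And>x. x \<in> cball z r \<Longrightarrow> l < v x"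
    and contH: "continuous_on {l..} H"
    and H: "\<And>t. l < t \<Longrightarrow> (H has_real_derivative \<eta> t) (at t)"
    and pos: "\<And>t. l < t \<Longrightarrow> \<eta> t > 0"
    and mono: "\<And>s t. l < s \<Longrightarrow> s \<le> t \<Longrightarrow> \<eta> s \<le> \<eta> t"
    and a: "l < a" "a < v z"
    and le: "(\<integral>\<^sup>+ t\<in>{l<..<a}. 1 / ennreal (root 4 (H a - H t)) \<partial>lborel) \<le> ennreal S" and "S \<ge> 0"
    and c: "c \<ge> 0" "S \<le> c * r" "c ^ 4 < 4"
    and x: "x \<in> cball z r" "v x < a"
  shows "(a - v x) ^ 3 \<le> c ^ 4 * \<eta> a * dist x z ^ 4"
proof -
  have Hinc: "H s < H t" if "l \<le> s" "s < t" for s t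
  proof (rule DERIV_pos_imp_increasing_open[OF that(2)])
    show "continuous_on {s..t} H" by (rule continuous_on_subset[OF contH]) (use that in auto)
    show "\<exists>d. (H has_real_derivative d) (at y) \<and> d > 0" if "s < y" "y < t" for y
      using H[of y] pos[of y] that \<open>l \<le> s\<close> by (intro exI[of _ "\<eta> y"]) simp
  qed
  obtain P where P: "continuous_on {l..a} P" "P l = 0" "P a \<le> S"
    "\<And>s. s \<in> {l<..<a} \<Longrightarrow> (P has_real_derivative (H a - H s) powr (-1/4)) (at s)"
  proof (rule singular_profile_primitive[OF a(1) _ _ le \<open>S \<ge> 0\<close>])
    show "continuous_on {l..a} H" by (rule continuous_on_subset[OF contH]) auto
  qed (use Hinc in auto)
  have Pinc: "P s < P t" if "l \<le> s" "s < t" "t \<le> a" for s t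
  proof (rule DERIV_pos_imp_increasing_open[OF that(2)])
    show "continuous_on {s..t} P" by (rule continuous_on_subset[OF P(1)]) (use that in auto)
    fix y assume y: "s < y" "y < t"
    then have "H a - H y > 0" using Hinc[of y a] that by simp
    then show "\<exists>d. (P has_real_derivative d) (at y) \<and> d > 0"
      using P(4)[of y] y that by (intro exI[of _ "(H a - H y) powr (-1/4)"]) simp
  qed
  \<comment> \<open>Truncation at \<open>a\<close> keeps the argument of \<open>P\<close> in
    \<open>{l..a}\<close> and, as \<open>a < v z\<close>, gives \<open>Y z = P a\<close>.\<close>
  define Y where "Y = (\<lambda>x. P (min (v x) a) + c * dist x z)"
  have "continuous_on (cball z r) Y"
    unfolding Y_def
    by (intro continuous_intros contv continuous_on_compose2[OF P(1)])
      (use vl a in \<open>auto simp: less_imp_le\<close>)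
  moreover have zr: "z \<in> cball z r" using \<open>r > 0\<close> by simp
  ultimately obtain q where q: "q \<in> cball z r" "\<And>w. w \<in> cball z r \<Longrightarrow> Y q \<le> Y w"
    using continuous_attains_inf[of "cball z r" Y] by (metis compact_cball empty_iff)
  have "P a \<le> Y q"
  proof (rule ccontr)
    assume "\<not> P a \<le> Y q"
    then have Yq: "Y q < P a" by simp
    have "P (min (v q) a) \<ge> 0"
      using Pinc[of l "min (v q) a"] vl[OF q(1)] a P(2) by simp
    have "q \<noteq> z" using Yq a by (auto simp: Y_def)
    have "c * dist q z \<ge> 0" using c(1) by simp
    then have "v q < a" using Yq by (cases "v q < a") (auto simp: Y_def min_def split: if_splits)
    \<comment> \<open>On the sphere the cone term alone is
      \<open>c r \<ge> S \<ge> P a\<close>.\<close>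
    have "dist q z \<noteq> r"
      using Yq \<open>P (min (v q) a) \<ge> 0\<close> c(2) P(3) by (auto simp: Y_def)
    then have qr: "q \<in> ball z r" using q(1) by (simp add: dist_commute)
    have vq: "l < v q" using vl q(1) by blast
    have contq: "isCont v q"
      using continuous_on_subset[OF contv ball_subset_cball] qr
      by (simp add: continuous_on_eq_continuous_at)
    have limv: "filterlim v (nhds (v q)) (nhds q)"
      using contq by (simp add: isCont_def tendsto_at_iff_tendsto_nhds)
    define k where "k = (\<lambda>s. (H a - H s) powr (-1/4))"
    define \<kappa> where "\<kappa> = k (v q)"
    have Hq: "H a - H (v q) > 0" using Hinc[of "v q" a] vq \<open>v q < a\<close> by simp
    then have \<kappa>: "\<kappa> > 0" by (simp add: \<kappa>_def k_def)
    have k1: "(k has_real_derivative \<eta> (v q) / 4 * \<kappa> ^ 5) (at (v q))"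
    proof -
      have "(k has_real_derivative (-1/4) * (H a - H (v q)) powr (-1/4 - 1) * (- \<eta> (v q))) (at (v q))"
        unfolding k_def
        by (rule derivative_eq_intros H vq Hq refl)+ (use Hq in auto)
      moreover have "(H a - H (v q)) powr (-1/4 - 1) = \<kappa> ^ 5"
        using Hq by (simp add: \<kappa>_def k_def powr_power)
      ultimately show ?thesis by (simp add: mult.commute)
    qed
    have in_la: "\<forall>\<^sub>F s in nhds (v q). s \<in> {l<..<a}"
      using vq \<open>v q < a\<close> by (intro eventually_nhds_in_open) auto
    then have k0: "\<forall>\<^sub>F s in nhds (v q). (P has_real_derivative k s) (at s)"
      unfolding k_def by eventually_elim (rule P(4))
    \<comment> \<open>For \<open>K = P\<close> the chain rule has \<open>K' = \<kappa>\<close> and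
      \<open>K'' = \<eta> \<kappa>^5 / 4\<close>, so the gradient coefficient is
      \<open>- \<eta> \<kappa>^3 / 4\<close> and the source is \<open>\<kappa>^3 N\<close>: both
      carry the factor \<open>\<kappa>^3\<close>, which cancels.\<close>
    have superP: "radial_supersol_at (\<lambda>x. P (v x)) (0 / \<kappa> - \<eta> (v q) / 4 * \<kappa> ^ 5 / \<kappa>\<^sup>2) (\<kappa> ^ 3 * N q) q"
      using radial_supersol_at_compose[OF super[OF qr] contq k0 k1] \<kappa> by (simp add: \<kappa>_def)
    have touch: "\<forall>\<^sub>F x in nhds q. P (v q) - (- c * dist q z) \<le> P (v x) - (- c * dist x z)"
      using eventually_compose_filterlim[OF in_la limv] eventually_nhds_in_open[OF open_ball qr]
    proof eventually_elim
      case (elim x)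
      then have "Y q \<le> Y x" by (intro q(2)) auto
      then show ?case using elim \<open>v q < a\<close> by (simp add: Y_def)
    qed
    have "(- c)\<^sup>2 * 0 + (0 / \<kappa> - \<eta> (v q) / 4 * \<kappa> ^ 5 / \<kappa>\<^sup>2) * (- c) ^ 4 + \<kappa> ^ 3 * N q \<le> 0"
      by (rule radial_supersol_atD[where ?\<psi>1.0 = "\<lambda>_. - c" and \<psi> = "\<lambda>t. - c * t",
            OF superP \<open>q \<noteq> z\<close> _ _ touch])
        (rule always_eventually allI DERIV_cmult_Id DERIV_const)+
    moreover have "\<kappa> ^ 5 / \<kappa>\<^sup>2 = \<kappa> ^ 3"
      using \<kappa> power_add[of \<kappa> 3 2] by (simp add: nonzero_divide_eq_eq)
    then have "(0 / \<kappa> - \<eta> (v q) / 4 * \<kappa> ^ 5 / \<kappa>\<^sup>2) * (- c) ^ 4 = - (\<kappa> ^ 3 * (\<eta> (v q) * (c ^ 4 / 4)))"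
      by (simp only: times_divide_eq_right[symmetric]) simp
    ultimately have "\<kappa> ^ 3 * N q \<le> \<kappa> ^ 3 * (\<eta> (v q) * (c ^ 4 / 4))" by linarith
    then have "N q \<le> \<eta> (v q) * (c ^ 4 / 4)" using \<kappa> by simp
    also have "\<dots> < \<eta> (v q) * 1" using pos[OF vq] c(3) by (intro mult_strict_left_mono) auto
    finally show False using N[OF qr] by simp
  qed
  also have "Y q \<le> P (v x) + c * dist x z" using q(2)[OF x(1)] x(2) by (simp add: Y_def)
  finally have Pd: "P a - P (v x) \<le> c * dist x z" by simp
  define s where "s = v x"
  have s: "l < s" "s < a" using vl x by (auto simp: s_def)
  obtain d y where y: "s < y" "y < a" "(P has_real_derivative d) (at y)" "P a - P s = (a - s) * d"
  proof (rule MVT[OF s(2), THEN exE])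
    show "continuous_on {s..a} P" by (rule continuous_on_subset[OF P(1)]) (use s in auto)
    show "P differentiable (at y)" if "s < y" "y < a" for y
      using P(4)[of y] that s by (auto simp: real_differentiable_def)
  qed blast
  have d: "d = (H a - H y) powr (-1/4)"
    using DERIV_unique[OF y(3) P(4)] y s by simp
  have "\<exists>w. y < w \<and> w < a \<and> H a - H y = (a - y) * \<eta> w"
    by (rule MVT2[OF y(2)]) (use y s H in auto)
  then obtain w where w: "y < w" "w < a" "H a - H y = (a - y) * \<eta> w" by blast
  have X: "H a - H y > 0" using Hinc[of y a] y s by simp
  have "H a - H y \<le> (a - s) * \<eta> a"
    unfolding w(3) using w y s mono[of w a] pos[of w] a by (intro mult_mono) auto
  \<comment> \<open>The slope \<open>d\<close> of \<open>P\<close> at \<open>y\<close> satisfies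
    \<open>(H a - H y) d^4 = 1\<close>.\<close>
  have "(a - s) ^ 4 = (H a - H y) * (P a - P s) ^ 4"
    using X by (simp add: y(4) d power_mult_distrib power_divide powr_power powr_minus_divide)
  also have "\<dots> \<le> ((a - s) * \<eta> a) * (c * dist x z) ^ 4"
    using \<open>H a - H y \<le> (a - s) * \<eta> a\<close> X Pd Pinc[of s a] s
    by (intro mult_mono power_mono) (simp_all add: s_def)
  finally have "(a - s) * (a - s) ^ 3 \<le> (a - s) * (c ^ 4 * \<eta> a * dist x z ^ 4)"
    using power_Suc[of "a - s" 3] by (simp add: power_mult_distrib mult_ac)
  then have "(a - s) ^ 3 \<le> c ^ 4 * \<eta> a * dist x z ^ 4"
    by (rule mult_left_le_imp_le) (use s in simp)
  then show ?thesis by (simp only: s_def)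
qed

section \<open>Calculus of \<open>Phi\<close>, \<open>H_fun\<close> and \<open>eta\<close>\<close>

lemma has_real_derivative_LBINT:
  fixes f :: "real \<Rightarrow> real"
  assumes contf: "continuous_on {a..b} f" and "a \<le> c" "c \<le> b" "a < x" "x < b"
  shows "((\<lambda>u. LBINT y=ereal c..ereal u. f y) has_real_derivative f x) (at x)"
proof -
  have "((\<lambda>u. LBINT y=c..u. f y) has_vector_derivative f x) (at x within {a..b})"
    using assms by (intro interval_integral_FTC2) auto
  then show ?thesis
    using assms at_within_interior[of x "{a..b}"]
    by (simp add: has_real_derivative_iff_has_vector_derivative)
qed

text \<open>Supplies continuity of \<open>H_fun\<close> up to the left endpoint, where
  \<open>has_real_derivative_LBINT\<close> does not apply.\<close>

lemma continuous_on_LBINT: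
  fixes f :: "real \<Rightarrow> real"
  assumes "continuous_on {l..} f"
  shows "continuous_on {l..} (\<lambda>u. LBINT y=ereal l..ereal u. f y)"
  unfolding continuous_on_eq_continuous_within
proof
  fix x assume x: "x \<in> {l..}"
  have "((\<lambda>u. LBINT y=l..u. f y) has_vector_derivative f x) (at x within {l..x + 1})"
    using x by (intro interval_integral_FTC2 continuous_on_subset[OF assms]) auto
  then have "continuous (at x within {l..x + 1}) (\<lambda>u. LBINT y=ereal l..ereal u. f y)"
    by (rule has_vector_derivative_continuous)
  moreover have "at x within {l..x + 1} = at x within {l..}"
    by (rule at_within_nhd[of x "{..<x + 1}"]) auto
  ultimately show "continuous (at x within {l..}) (\<lambda>u. LBINT y=ereal l..ereal u. f y)" by simp
qed

context
  fixes g :: "real \<Rightarrow> real"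
  assumes contg: "continuous_on UNIV g"
begin

lemma G_prim_has_derivative: "(G_prim g has_real_derivative g s) (at s)"
  using has_real_derivative_LBINT[of "- \<bar>s\<bar> - 1" "\<bar>s\<bar> + 1" g 0 s] continuous_on_subset[OF contg]
  by (simp add: G_prim_def[abs_def] zero_ereal_def)

lemma Phi_has_derivative: "(Phi g has_real_derivative exp (G_prim g s)) (at s)"
proof -
  have "continuous_on A (G_prim g)" for A
    by (intro continuous_at_imp_continuous_on ballI DERIV_isCont[OF G_prim_has_derivative])
  then have "continuous_on A (\<lambda>s. exp (G_prim g s))" for A
    by (intro continuous_intros)
  then show ?thesis
    using has_real_derivative_LBINT[of "- \<bar>s\<bar> - 1" "\<bar>s\<bar> + 1" "\<lambda>s. exp (G_prim g s)" 0 s]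
    by (simp add: Phi_def[abs_def] zero_ereal_def)
qed

lemma inj_Phi: "inj (Phi g)"
proof -
  have "strict_mono (Phi g)"
    by (rule strict_monoI, rule DERIV_pos_imp_increasing) (auto intro: Phi_has_derivative)
  then show ?thesis by (rule strict_mono_imp_inj_on)
qed

text \<open>The pair \<open>(x, Phi g s)\<close> lies in the index set of the infimum, and there
  \<open>inv (Phi g)\<close> cancels by injectivity.\<close>

lemma eta_Phi_le:
  assumes "x \<in> \<Omega>" "\<forall>x\<in>\<Omega>. \<forall>t. f x t \<ge> 0"
  shows "eta \<Omega> f g (Phi g s) \<le> exp (3 * G_prim g s) * f x s"
proof -
  have "(INF (x, t)\<in>\<Omega> \<times> {Phi g s..}. exp (3 * G_prim g (inv (Phi g) t)) * f x (inv (Phi g) t))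
      \<le> (case (x, Phi g s) of (x, t) \<Rightarrow> exp (3 * G_prim g (inv (Phi g) t)) * f x (inv (Phi g) t))"
    by (rule cINF_lower) (use assms in \<open>auto intro!: bdd_belowI2[where m = 0]\<close>)
  then show ?thesis by (simp add: eta_def inv_f_f[OF inj_Phi])
qed

text \<open>With \<open>K = \<Phi>\<^sub>g\<close> we have \<open>K'' = g K'\<close>, so the gradient term disappears.\<close>

lemma radial_supersol_at_Phi:
  assumes "visc_supersolution \<Omega> f g u" "x \<in> \<Omega>" "isCont u x"
  shows "radial_supersol_at (\<lambda>x. Phi g (u x)) 0 (exp (3 * G_prim g (u x)) * f x (u x)) x"
proof -
  have "((\<lambda>s. exp (G_prim g s)) has_real_derivative exp (G_prim g (u x)) * g (u x)) (at (u x))"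
    by (rule derivative_eq_intros G_prim_has_derivative refl)+
  from radial_supersol_at_compose[OF visc_supersolution_imp_radial[OF assms(1,2)] assms(3)
      always_eventually[OF allI[OF Phi_has_derivative]] this]
  show ?thesis by (simp add: power2_eq_square exp_of_nat_mult[symmetric])
qed

end

lemma eta_mono:
  assumes "\<Omega> \<noteq> {}" "\<forall>x\<in>\<Omega>. \<forall>t. f x t \<ge> 0" "s \<le> t"
  shows "eta \<Omega> f g s \<le> eta \<Omega> f g t"
  unfolding eta_def
  by (rule cINF_superset_mono) (use assms in \<open>auto intro!: bdd_belowI2[where m = 0]\<close>)

section \<open>The dichotomy and the contradiction on a large ball\<close>

text \<open>Either an interior point attains the minimum over the closure and the strong minimum
  principle applies, or the minimum is attained on the frontier only.\<close>

lemma minimum_on_boundary_or_constant: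
  fixes v :: "real ^ 'n \<Rightarrow> real"
  assumes \<Omega>: "open \<Omega>" "connected \<Omega>" "\<Omega> \<noteq> {}" "bounded \<Omega>"
    and cont: "continuous_on (closure \<Omega>) v"
    and super: "\<And>x. x \<in> \<Omega> \<Longrightarrow> radial_supersol_at v 0 (N x) x"
    and N: "\<And>x. x \<in> \<Omega> \<Longrightarrow> N x \<ge> 0"
  shows "v constant_on closure \<Omega> \<or> (\<forall>x\<in>\<Omega>. (INF y\<in>frontier \<Omega>. v y) < v x)"
proof -
  have comp: "compact (closure \<Omega>)" using \<Omega>(4) by (simp add: compact_closure)
  have "closure \<Omega> \<noteq> {}" using \<Omega>(3) by simp
  then obtain p where p: "p \<in> closure \<Omega>" "\<And>x. x \<in> closure \<Omega> \<Longrightarrow> v p \<le> v x"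
    using continuous_attains_inf[OF comp _ cont] by blast
  show ?thesis
  proof (cases "\<exists>q\<in>\<Omega>. v q = v p")
    case True
    then obtain q where q: "q \<in> \<Omega>" "v q = v p" by blast
    have "v x = v p" if "x \<in> \<Omega>" for x
      by (rule strong_minimum_principle[OF \<Omega>(1,2) _ _ super N q that])
        (use p(2) closure_subset in \<open>auto intro: continuous_on_subset[OF cont]\<close>)
    then have "v x = v p" if "x \<in> closure \<Omega>" for x
      using continuous_constant_on_closure[OF cont] that by blast
    then show ?thesis by (auto simp: constant_on_def)
  next
    case False
    then have "p \<in> frontier \<Omega>" using p(1) \<Omega>(1) by (auto simp: frontier_def interior_open)
    moreover have "bdd_below (v ` frontier \<Omega>)"
      by (rule bdd_belowI2[where m = "v p"]) (auto simp: frontier_def intro: p(2))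
    ultimately have "(INF y\<in>frontier \<Omega>. v y) \<le> v p" by (intro cINF_lower)
    moreover have "v p < v x" if "x \<in> \<Omega>" for x
      using p(2)[of x] False that closure_subset[of \<Omega>] by (metis less_le subsetD)
    ultimately show ?thesis by force
  qed
qed

text \<open>The growth bound holds with every vertex near \<open>z\<close>, so it can be applied
  with the roles of two points exchanged; this makes it a two-sided Hoelder estimate.\<close>

lemma no_supersolution_on_large_ball:
  fixes v :: "real ^ 'n \<Rightarrow> real"
  assumes contv: "continuous_on (ball z R) v"
    and super: "\<And>x. x \<in> ball z R \<Longrightarrow> radial_supersol_at v 0 (N x) x"
    and N: "\<And>x. x \<in> ball z R \<Longrightarrow> \<eta> (v x) \<le> N x"
    and vl: "\<And>x. x \<in> ball z R \<Longrightarrow> l < v x"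
    and contH: "continuous_on {l..} H"
    and H: "\<And>t. l < t \<Longrightarrow> (H has_real_derivative \<eta> t) (at t)"
    and pos: "\<And>t. l < t \<Longrightarrow> \<eta> t > 0"
    and mono: "\<And>s t. l < s \<Longrightarrow> s \<le> t \<Longrightarrow> \<eta> s \<le> \<eta> t"
    and le: "\<And>a. l < a \<Longrightarrow>
      (\<integral>\<^sup>+ t\<in>{l<..<a}. 1 / ennreal (root 4 (H a - H t)) \<partial>lborel) \<le> ennreal S"
    and S: "S \<ge> 0" "S < sqrt 2 * R"
  shows False
proof -
  \<comment> \<open>The midpoint of \<open>S / sqrt 2\<close> and \<open>R\<close>: then
    \<open>c r = S\<close> with \<open>c < sqrt 2\<close>, and there is room to move the
    centre.\<close>
  define r where "r = (R + S / sqrt 2) / 2"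
  define c where "c = S / r"
  have "S / sqrt 2 < R" using S by (simp add: field_simps)
  moreover have "S / sqrt 2 \<ge> 0" using S by simp
  moreover have "2 * r = R + S / sqrt 2" by (simp add: r_def)
  ultimately have r: "0 < r" "r < R" "S / sqrt 2 < r" by linarith+
  have c: "c \<ge> 0" "S \<le> c * r" using S r by (auto simp: c_def)
  have "c < sqrt 2" using r by (simp add: c_def field_simps)
  then have "c ^ 4 < sqrt 2 ^ 4" using c(1) by (intro power_strict_mono) auto
  also have "sqrt 2 ^ 4 = (4::real)" using real_sqrt_pow2[of 2] power_mult[of "sqrt 2" 2 2] by simp
  finally have c4: "c ^ 4 < 4" .
  \<comment> \<open>\<open>R - r\<close> keeps \<open>cball z' r\<close> inside
    \<open>ball z R\<close>; \<open>r / 2\<close> puts any two points near \<open>z\<close> within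
    distance \<open>r\<close> of each other.\<close>
  define \<delta> where "\<delta> = min (R - r) (r / 2)"
  have \<delta>: "\<delta> > 0" using r by (simp add: \<delta>_def)
  have growth: "(v z' - v x) ^ 3 \<le> c ^ 4 * \<eta> (v z') * dist x z' ^ 4"
    if z': "z' \<in> ball z \<delta>" and x: "x \<in> cball z' r" and less: "v x < v z'" for x z'
  proof (rule ccontr)
    assume contra: "\<not> ?thesis"
    have sub: "cball z' r \<subseteq> ball z R"
    proof
      fix w assume "w \<in> cball z' r"
      then show "w \<in> ball z R"
        using z' dist_triangle[of z w z'] by (simp add: \<delta>_def)
    qed
    define B where "B = c ^ 4 * \<eta> (v z') * dist x z' ^ 4"
    \<comment> \<open>The growth bound needs \<open>a < v z'\<close>. If the limiting inequality
      failed, it would already fail for some such \<open>a\<close>, since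
      \<open>\<eta> a \<le> \<eta> (v z')\<close>.\<close>
    have "((\<lambda>a. (a - v x) ^ 3) \<longlongrightarrow> (v z' - v x) ^ 3) (at_left (v z'))"
      by (intro tendsto_intros)
    then have "\<forall>\<^sub>F a in at_left (v z'). B < (a - v x) ^ 3"
      by (rule order_tendstoD) (use contra in \<open>simp add: B_def\<close>)
    moreover have "\<forall>\<^sub>F a in at_left (v z'). a \<in> {v x<..<v z'}"
      using less by (rule eventually_at_left_real)
    ultimately have "\<forall>\<^sub>F a in at_left (v z'). B < (a - v x) ^ 3 \<and> a \<in> {v x<..<v z'}"
      by eventually_elim simp
    from eventually_happens'[OF trivial_limit_at_left_real this]
    obtain a where a: "B < (a - v x) ^ 3" "v x < a" "a < v z'" by auto
    have "x \<in> ball z R" using x sub by blast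
    then have la: "l < a" using a(2) vl[of x] by simp
    have "(a - v x) ^ 3 \<le> c ^ 4 * \<eta> a * dist x z' ^ 4"
    proof (rule radial_supersol_growth_bound[OF r(1) continuous_on_subset[OF contv sub] _ _ _
          contH H pos mono la a(3) le[OF la] S(1) c c4 x a(2)])
      show "radial_supersol_at v 0 (N w) w" if "w \<in> ball z' r" for w
        using super[of w] subsetD[OF sub, of w] that by simp
      show "\<eta> (v w) \<le> N w" if "w \<in> ball z' r" for w
        using N[of w] subsetD[OF sub, of w] that by simp
      show "l < v w" if "w \<in> cball z' r" for w
        using vl[of w] subsetD[OF sub, of w] that by simp
    qed
    also have "\<dots> \<le> B"
      unfolding B_def using c(1) la a(3) mono by (intro mult_right_mono mult_left_mono) auto
    finally show False using a(1) by simp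
  qed
  have zR: "z \<in> ball z R" using r by simp
  have "isCont v z" using contv zR by (simp add: continuous_on_eq_continuous_at)
  then have "\<forall>\<^sub>F x in at z. v x < v z + 1"
    unfolding isCont_def by (rule order_tendstoD) simp
  then obtain \<delta>' where \<delta>': "\<delta>' > 0" "\<And>x. dist x z < \<delta>' \<Longrightarrow> v x < v z + 1"
    unfolding eventually_at by (metis UNIV_I less_add_one)
  define \<epsilon> where "\<epsilon> = min \<delta> \<delta>'"
  have \<epsilon>: "\<epsilon> > 0" using \<delta> \<delta>' by (simp add: \<epsilon>_def)
  \<comment> \<open>Near \<open>z\<close> one has \<open>v < v z + 1\<close>, so monotonicity of
    \<open>\<eta>\<close> gives one constant for all vertices.\<close>
  define C where "C = c ^ 4 * \<eta> (v z + 1)"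
  have one: "(v y - v x) ^ 3 \<le> C * dist x y ^ 4"
    if "x \<in> ball z \<epsilon>" "y \<in> ball z \<epsilon>" "v x < v y" for x y
  proof -
    have x: "dist z x < r / 2" and y: "dist z y < r / 2" using that by (auto simp: \<epsilon>_def \<delta>_def)
    then have "x \<in> cball y r" using dist_triangle3[of y x z] by simp
    then have "(v y - v x) ^ 3 \<le> c ^ 4 * \<eta> (v y) * dist x y ^ 4"
      using that by (intro growth) (auto simp: \<epsilon>_def)
    also have "\<dots> \<le> C * dist x y ^ 4"
    proof -
      have "y \<in> ball z R" using y r by simp
      then have "\<eta> (v y) \<le> \<eta> (v z + 1)"
        using \<delta>'(2)[of y] that(2) vl[of y] by (intro mono) (simp_all add: \<epsilon>_def dist_commute[of z])
      then show ?thesis unfolding C_def using c(1) by (intro mult_right_mono mult_left_mono) auto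
    qed
    finally show ?thesis .
  qed
  have C: "C \<ge> 0" unfolding C_def using c(1) pos[of "v z + 1"] vl[OF zR] by simp
  have "v x = v z" if "x \<in> ball z \<epsilon>" for x
  proof (rule constant_on_ball_if_Hoelder_four_thirds[OF _ that])
    fix x y assume xy: "x \<in> ball z \<epsilon>" "y \<in> ball z \<epsilon>"
    have "v x < v y \<Longrightarrow> (v y - v x) ^ 3 \<le> C * dist x y ^ 4"
      by (rule one[OF xy])
    moreover have "v y < v x \<Longrightarrow> (v x - v y) ^ 3 \<le> C * dist x y ^ 4"
      unfolding dist_commute[of x y] by (rule one[OF xy(2,1)])
    moreover have "0 \<le> C * dist x y ^ 4" using C by simp
    ultimately show "\<bar>v x - v y\<bar> ^ 3 \<le> C * dist x y ^ 4"
      by (cases "v x" "v y" rule: linorder_cases) simp_all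
  qed
  then have "\<forall>x. dist x z < \<epsilon> \<longrightarrow> v z - 0 \<le> v x - 0"
    by (simp add: dist_commute[of z])
  then have "\<forall>\<^sub>F x in nhds z. v z - 0 \<le> v x - 0"
    unfolding eventually_nhds_metric using \<epsilon> by blast
  \<comment> \<open>Radial tests need a centre different from the touching point; the zero function,
    centred at \<open>z'\<close>, then yields \<open>N z \<le> 0\<close>.\<close>
  moreover obtain z' where "z \<noteq> z'" using UNIV_not_singleton[of z] UNIV_eq_I[of "{z}"] by (metis insertI1)
  ultimately have "0\<^sup>2 * 0 + 0 * 0 ^ 4 + N z \<le> (0::real)"
    by (intro radial_supersol_atD[OF super[OF zR], where \<psi> = "\<lambda>_. 0" and ?\<psi>1.0 = "\<lambda>_. 0"]) auto
  then show False using N[OF zR] pos[OF vl[OF zR]] by simp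
qed

theorem theorem6:
  fixes \<Omega> :: "(real ^ 'n) set"
    and b :: "real ^ 'n \<Rightarrow> real"
    and f :: "real ^ 'n \<Rightarrow> real \<Rightarrow> real"
    and g :: "real \<Rightarrow> real"
    and z :: "real ^ 'n"
    and R :: real
  assumes "CARD('n) \<ge> 2"
    and "open \<Omega>" and "connected \<Omega>" and "\<Omega> \<noteq> {}" and "bounded \<Omega>"
    and "continuous_on (frontier \<Omega>) b"
    and "continuous_on UNIV g"
    and "\<exists>s0\<ge>0. (\<forall>s\<ge>s0. g s \<ge> 0) \<and> (\<forall>s\<le>-s0. g s \<le> 0)"
    and "continuous_on (\<Omega> \<times> UNIV) (\<lambda>(x, t). f x t)"
    and "\<forall>x\<in>\<Omega>. \<forall>t. f x t \<ge> 0"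
    and "\<forall>c d. bdd_above ((\<lambda>(x, t). \<bar>f x t\<bar>) ` (\<Omega> \<times> {c..d}))"
    and "continuous_on {ell \<Omega> b g..} (eta \<Omega> f g)"
    and "\<forall>t>ell \<Omega> b g. eta \<Omega> f g t > 0"
    and "S_sup \<Omega> b f g < \<infinity>"
    and "is_in_ball \<Omega> z R"
    and "R > enn2real (S_sup \<Omega> b f g) / sqrt 2"
  shows "\<forall>u. visc_solution \<Omega> b f g u \<longrightarrow> u constant_on closure \<Omega>"
proof (intro allI impI)
  fix u assume u: "visc_solution \<Omega> b f g u"
  note contg = assms(7) and fnn = assms(10)
  define l where "l = ell \<Omega> b g"
  define v where "v = (\<lambda>x. Phi g (u x))"
  define N where "N = (\<lambda>x. exp (3 * G_prim g (u x)) * f x (u x))"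
  have contu: "continuous_on (closure \<Omega>) u" and ub: "\<And>x. x \<in> frontier \<Omega> \<Longrightarrow> u x = b x"
    and sup: "visc_supersolution \<Omega> f g u"
    using u by (auto simp: visc_solution_def)
  have "continuous_on UNIV (Phi g)"
    by (intro continuous_at_imp_continuous_on ballI DERIV_isCont[OF Phi_has_derivative[OF contg]])
  then have contv: "continuous_on (closure \<Omega>) v"
    unfolding v_def by (rule continuous_on_compose2) (use contu in auto)
  have super: "radial_supersol_at v 0 (N x) x" if "x \<in> \<Omega>" for x
  proof -
    have "isCont u x"
      using continuous_on_subset[OF contu closure_subset] that \<open>open \<Omega>\<close>
      by (simp add: continuous_on_eq_continuous_at)
    then show ?thesis unfolding v_def N_def by (rule radial_supersol_at_Phi[OF contg sup that])
  qed
  have N: "eta \<Omega> f g (v x) \<le> N x" if "x \<in> \<Omega>" for x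
    unfolding v_def N_def by (rule eta_Phi_le[OF contg that fnn])
  \<comment> \<open>The boundary condition enters here: \<open>u = b\<close> on the
    frontier.\<close>
  have l: "l = (INF x\<in>frontier \<Omega>. v x)"
    unfolding l_def ell_def v_def by (intro INF_cong refl) (simp add: ub)
  have "v constant_on closure \<Omega> \<or> (\<forall>x\<in>\<Omega>. l < v x)"
    unfolding l using minimum_on_boundary_or_constant[OF assms(2-5) contv super] fnn
    by (auto simp: N_def)
  then show "u constant_on closure \<Omega>"
  proof
    assume "v constant_on closure \<Omega>"
    then show ?thesis
      using inj_Phi[OF contg] unfolding constant_on_def v_def by (metis injD)
  next
    assume vl: "\<forall>x\<in>\<Omega>. l < v x"
    define H where "H = H_fun \<Omega> b f g"
    define S where "S = enn2real (S_sup \<Omega> b f g)"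
    have ball: "ball z R \<subseteq> \<Omega>" using assms(15) by (simp add: is_in_ball_def)
    have H_eq: "H = (\<lambda>t. LBINT s=ereal l..ereal t. eta \<Omega> f g s)"
      by (simp add: H_def H_fun_def[abs_def] l_def)
    have False
    proof (rule no_supersolution_on_large_ball[of z R v N "eta \<Omega> f g" l H S])
      show "continuous_on (ball z R) v"
        using continuous_on_subset[OF contv] ball closure_subset by blast
      show "continuous_on {l..} H"
        unfolding H_eq using assms(12) by (intro continuous_on_LBINT) (simp add: l_def)
      show "(H has_real_derivative eta \<Omega> f g t) (at t)" if "l < t" for t
        unfolding H_eq
        by (rule has_real_derivative_LBINT[of l "t + 1"])
          (use that assms(12) in \<open>auto simp: l_def intro: continuous_on_subset\<close>)
      show "(\<integral>\<^sup>+ t\<in>{l<..<a}. 1 / ennreal (root 4 (H a - H t)) \<partial>lborel) \<le> ennreal S" if "l < a" for a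
      proof -
        have "zeta \<Omega> b f g a \<le> S_sup \<Omega> b f g"
          unfolding S_sup_def using that by (intro SUP_upper) (simp add: l_def)
        also have "\<dots> = ennreal S" using assms(14) by (simp add: S_def)
        finally show ?thesis by (simp add: zeta_def H_def l_def)
      qed
      show "S < sqrt 2 * R" using assms(16) by (simp add: S_def field_simps)
      show "eta \<Omega> f g s \<le> eta \<Omega> f g t" if "s \<le> t" for s t
        by (rule eta_mono[OF assms(4) fnn that])
      show "eta \<Omega> f g t > 0" if "l < t" for t
        using assms(13) that by (simp add: l_def)
      show "S \<ge> 0" by (simp add: S_def)
      show "radial_supersol_at v 0 (N x) x" "eta \<Omega> f g (v x) \<le> N x" "l < v x" if "x \<in> ball z R" for x
        using super N vl ball that by auto
    qed
    then show ?thesis ..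
  qed
qed

end
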